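(* Let $\Gamma$ be a finitely generated, residually finite group with finite generating set $S$, and let $k,n$ be positive integers. If $|B^S_\Gamma(k)|>i^{\lhd}_\Gamma(n)$, then $F^S_\Gamma(2k)\ge n$.
   Context: $B^S_\Gamma(r)$ is the set of elements of $\Gamma$ that can be written as a word of length at most $r$ in $S\cup S^{-1}$. $i^{\lhd}_\Gamma(n)$ is the index in $\Gamma$ of the intersection of all normal subgroups of $\Gamma$ of index at most $n$. For $1\ne g\in\Gamma$, $k_\Gamma(g)=\min\{[\Gamma:N] : N\unlhd\Gamma,\ g\notin N\}$, which is finite since $\Gamma$ is residually finite. The residual finiteness growth function is $F^S_\Gamma(r)=\max\{k_\Gamma(g): g\in B^S_\Gamma(r),\ g\neq 1\}$. *)

theory Defs
  imports "HOL-Algebra.Generated_Groups" "HOL-Library.Extended_Nat"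
begin

definition index :: "('a, 'b) monoid_scheme \<Rightarrow> 'a set \<Rightarrow> enat" where
  "index G H = (if finite (rcosets\<^bsub>G\<^esub> H) then enat (card (rcosets\<^bsub>G\<^esub> H)) else \<infinity>)"

definition residually_finite :: "('a, 'b) monoid_scheme \<Rightarrow> bool" where
  "residually_finite G \<longleftrightarrow>
    (\<forall>g \<in> carrier G. g \<noteq> \<one>\<^bsub>G\<^esub> \<longrightarrow> (\<exists>N. N \<lhd> G \<and> index G N < \<infinity> \<and> g \<notin> N))"

definition word_ball :: "('a, 'b) monoid_scheme \<Rightarrow> 'a set \<Rightarrow> nat \<Rightarrow> 'a set" where
  "word_ball G S r =
    {foldr (\<otimes>\<^bsub>G\<^esub>) w \<one>\<^bsub>G\<^esub> | w. set w \<subseteq> S \<union> set_inv\<^bsub>G\<^esub> S \<and> length w \<le> r}"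

(* For n = 0 the family of subgroups is empty; the definition is meant for n > 0. *)
definition normal_intersection_index :: "('a, 'b) monoid_scheme \<Rightarrow> nat \<Rightarrow> enat" where
  "normal_intersection_index G n = index G (\<Inter>{N. N \<lhd> G \<and> index G N \<le> enat n})"

(* A minimum only if some normal subgroup of finite index avoids g, as is the case for
   every g \<noteq> \<one> of a residually finite group. *)
definition detection_index :: "('a, 'b) monoid_scheme \<Rightarrow> 'a \<Rightarrow> nat" where
  "detection_index G g = (LEAST m. \<exists>N. N \<lhd> G \<and> g \<notin> N \<and> index G N = enat m)"

(* The maximum is over a finite set when S is finite; it is unspecified when the ball
   contains no nontrivial element. *)
definition rf_growth :: "('a, 'b) monoid_scheme \<Rightarrow> 'a set \<Rightarrow> nat \<Rightarrow> nat" where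
  "rf_growth G S r = Max {detection_index G g | g. g \<in> word_ball G S r \<and> g \<noteq> \<one>\<^bsub>G\<^esub>}"

end

theory Submission
  imports Defs
begin

text \<open>The quotient by the intersection \<open>K\<close> of all normal subgroups of index at most \<open>n\<close> has
  fewer elements than the ball of radius \<open>k\<close>, so two distinct elements \<open>x\<close>, \<open>y\<close> of the ball lie
  in one coset of \<open>K\<close> (pigeonhole). Then \<open>x y\<^sup>-\<^sup>1\<close> is a nontrivial element of the ball of radius
  \<open>2 k\<close> and lies in every normal subgroup of index at most \<open>n\<close>. Hence any normal subgroup that
  avoids it has index greater than \<open>n\<close>, and the same bound holds for the growth function at
  \<open>2 k\<close>. Residual finiteness makes \<open>detection_index\<close> an attained minimum, and finiteness of
  \<open>S\<close> makes \<open>rf_growth\<close> a maximum over a finite set.\<close>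

lemma finite_word_ball:
  assumes "finite S"
  shows "finite (word_ball G S r)"
proof -
  have "finite (S \<union> set_inv\<^bsub>G\<^esub> S)"
    using assms by (simp add: SET_INV_def)
  then have "finite {w. set w \<subseteq> S \<union> set_inv\<^bsub>G\<^esub> S \<and> length w \<le> r}"
    by (rule finite_lists_length_le)
  moreover have "word_ball G S r =
      (\<lambda>w. foldr (\<otimes>\<^bsub>G\<^esub>) w \<one>\<^bsub>G\<^esub>) ` {w. set w \<subseteq> S \<union> set_inv\<^bsub>G\<^esub> S \<and> length w \<le> r}"
    by (auto simp: word_ball_def)
  ultimately show ?thesis
    by simp
qed

context group
begin

lemma foldr_mult_closed:
  "set w \<subseteq> carrier G \<Longrightarrow> foldr (\<otimes>) w \<one> \<in> carrier G"
  by (induction w) auto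

lemma foldr_mult_append:
  assumes "set u \<subseteq> carrier G" "set v \<subseteq> carrier G"
  shows "foldr (\<otimes>) (u @ v) \<one> = foldr (\<otimes>) u \<one> \<otimes> foldr (\<otimes>) v \<one>"
  using assms by (induction u) (auto simp del: foldr_append simp: foldr_mult_closed m_assoc)

lemma inv_foldr_mult:
  assumes "set w \<subseteq> carrier G"
  shows "inv (foldr (\<otimes>) w \<one>) = foldr (\<otimes>) (rev (map (m_inv G) w)) \<one>"
  using assms
proof (induction w)
  case Nil
  then show ?case by simp
next
  case (Cons a w)
  have c: "set (rev (map (m_inv G) w)) \<subseteq> carrier G" "set [inv a] \<subseteq> carrier G"
    using Cons.prems by auto
  have "foldr (\<otimes>) (rev (map (m_inv G) (a # w))) \<one>
      = foldr (\<otimes>) (rev (map (m_inv G) w)) \<one> \<otimes> foldr (\<otimes>) [inv a] \<one>"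
    using foldr_mult_append[OF c] by simp
  also have "\<dots> = inv (foldr (\<otimes>) w \<one>) \<otimes> inv a"
    using Cons by simp
  also have "\<dots> = inv (foldr (\<otimes>) (a # w) \<one>)"
    using Cons.prems foldr_mult_closed by (simp add: inv_mult_group)
  finally show ?case ..
qed

lemma word_ball_subset_carrier:
  assumes "S \<subseteq> carrier G"
  shows "word_ball G S r \<subseteq> carrier G"
proof -
  have "S \<union> set_inv S \<subseteq> carrier G"
    using assms by (auto simp: SET_INV_def)
  then show ?thesis
    using foldr_mult_closed by (force simp: word_ball_def)
qed

lemma word_ball_mult_inv:
  assumes S: "S \<subseteq> carrier G" and x: "x \<in> word_ball G S r" and y: "y \<in> word_ball G S s"
  shows "x \<otimes> inv y \<in> word_ball G S (r + s)"
proof -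
  let ?A = "S \<union> set_inv S"
  have A: "?A \<subseteq> carrier G" and A_inv: "\<And>a. a \<in> ?A \<Longrightarrow> inv a \<in> ?A"
    using S by (auto simp: SET_INV_def)
  obtain u where u: "set u \<subseteq> ?A" "length u \<le> r" "x = foldr (\<otimes>) u \<one>"
    using x by (auto simp: word_ball_def)
  obtain v where v: "set v \<subseteq> ?A" "length v \<le> s" "y = foldr (\<otimes>) v \<one>"
    using y by (auto simp: word_ball_def)
  define w where "w = u @ rev (map (m_inv G) v)"
  have v': "set (rev (map (m_inv G) v)) \<subseteq> ?A"
    using v(1) A_inv by auto
  have "x \<otimes> inv y = foldr (\<otimes>) w \<one>"
    using foldr_mult_append[of u "rev (map (m_inv G) v)"] inv_foldr_mult[of v] u v v' A
    unfolding w_def by (metis subset_trans)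
  moreover have "set w \<subseteq> ?A"
    using u v' by (simp add: w_def)
  moreover have "length w \<le> r + s"
    using u v by (simp add: w_def)
  ultimately show ?thesis
    unfolding word_ball_def by blast
qed

lemma normal_carrier: "carrier G \<lhd> G"
  by (rule normal_invI) (auto simp: subgroup_self)

lemma index_carrier: "index G (carrier G) = enat 1"
proof -
  have "rcosets (carrier G) = {carrier G}"
    using coset_join2[OF _ subgroup_self] by (auto simp: RCOSETS_def)
  then show ?thesis
    by (simp add: index_def)
qed

text \<open>The hypothesis \<open>n > 0\<close> puts the whole group into the family, so that the intersection is
  taken inside the carrier.\<close>

lemma subgroup_Inter_normal_index_le:
  assumes "n > 0"
  shows "subgroup (\<Inter>{N. N \<lhd> G \<and> index G N \<le> enat n}) G"
proof (rule subgroups_Inter)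
  show "{N. N \<lhd> G \<and> index G N \<le> enat n} \<noteq> {}"
    using normal_carrier index_carrier assms by auto
qed (auto intro: normal_imp_subgroup)

lemma finite_index_pigeonhole:
  assumes K: "subgroup K G" and B: "B \<subseteq> carrier G" "finite B"
    and less: "index G K < enat (card B)"
  obtains x y where "x \<in> B" "y \<in> B" "x \<noteq> y" "x \<otimes> inv y \<in> K"
proof -
  have fin: "finite (rcosets K)" and card: "card (rcosets K) < card B"
    using less by (auto simp: index_def split: if_splits)
  have "(\<lambda>x. K #> x) ` B \<subseteq> rcosets K"
    using B by (auto simp: RCOSETS_def)
  then have "card ((\<lambda>x. K #> x) ` B) < card B"
    using card_mono[OF fin] card by (meson le_less_trans)
  then obtain x y where xy: "x \<in> B" "y \<in> B" "x \<noteq> y" "K #> x = K #> y"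
    using pigeonhole unfolding inj_on_def by blast
  then have "x \<in> K #> y"
    using rcos_self[OF _ K] B by blast
  then have "x \<otimes> inv y \<in> K"
    using subgroup.rcos_module_imp[OF K is_group] xy B by blast
  with xy that show thesis by blast
qed

lemma detection_index_attained:
  assumes "residually_finite G" "g \<in> carrier G" "g \<noteq> \<one>"
  obtains N where "N \<lhd> G" "g \<notin> N" "index G N = enat (detection_index G g)"
proof -
  obtain N where "N \<lhd> G" "index G N < \<infinity>" "g \<notin> N"
    using assms by (auto simp: residually_finite_def)
  then have "\<exists>m. \<exists>N. N \<lhd> G \<and> g \<notin> N \<and> index G N = enat m"
    by (metis enat_ord_simps(4) not_infinity_eq)
  then have "\<exists>N. N \<lhd> G \<and> g \<notin> N \<and> index G N = enat (detection_index G g)"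
    unfolding detection_index_def by (rule LeastI_ex)
  with that show thesis by blast
qed

end

theorem mainTheorem5:
  fixes \<Gamma> :: "('a, 'b) monoid_scheme" and S :: "'a set" and k n :: nat
  assumes "group \<Gamma>"
    and "residually_finite \<Gamma>"
    and "finite S" and "S \<subseteq> carrier \<Gamma>" and "generate \<Gamma> S = carrier \<Gamma>"
    and "k > 0" and "n > 0"
    and "enat (card (word_ball \<Gamma> S k)) > normal_intersection_index \<Gamma> n"
  shows "rf_growth \<Gamma> S (2 * k) \<ge> n"
proof -
  interpret group \<Gamma> by fact
  let ?K = "\<Inter>{N. N \<lhd> \<Gamma> \<and> index \<Gamma> N \<le> enat n}"
  have ball: "word_ball \<Gamma> S r \<subseteq> carrier \<Gamma>" for r
    using assms(4) by (rule word_ball_subset_carrier)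
  have K: "subgroup ?K \<Gamma>"
    using assms(7) by (rule subgroup_Inter_normal_index_le)
  have "index \<Gamma> ?K < enat (card (word_ball \<Gamma> S k))"
    using assms(8) by (simp only: normal_intersection_index_def)
  then obtain x y where xy: "x \<in> word_ball \<Gamma> S k" "y \<in> word_ball \<Gamma> S k" "x \<noteq> y"
    and in_K: "x \<otimes>\<^bsub>\<Gamma>\<^esub> inv\<^bsub>\<Gamma>\<^esub> y \<in> ?K"
    by (rule finite_index_pigeonhole[OF K ball finite_word_ball[OF assms(3)]])
  define g where "g = x \<otimes>\<^bsub>\<Gamma>\<^esub> inv\<^bsub>\<Gamma>\<^esub> y"
  have g_ball: "g \<in> word_ball \<Gamma> S (2 * k)"
    using word_ball_mult_inv[OF assms(4) xy(1,2)] by (simp add: g_def mult_2)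
  have "x \<in> carrier \<Gamma>" "y \<in> carrier \<Gamma>"
    using xy ball by auto
  then have g_ne: "g \<noteq> \<one>\<^bsub>\<Gamma>\<^esub>"
    using xy(3) inv_equality[of x "inv\<^bsub>\<Gamma>\<^esub> y"] by (auto simp: g_def)
  obtain N where N: "N \<lhd> \<Gamma>" "g \<notin> N" "index \<Gamma> N = enat (detection_index \<Gamma> g)"
    using detection_index_attained assms(2) g_ball g_ne ball by blast
  have "n \<le> detection_index \<Gamma> g"
  proof (rule ccontr)
    assume "\<not> n \<le> detection_index \<Gamma> g"
    then have "g \<in> N"
      using in_K N by (auto simp: g_def)
    with N show False by blast
  qed
  also have "\<dots> \<le> rf_growth \<Gamma> S (2 * k)"
    unfolding rf_growth_def
  proof (rule Max_ge)
    show "finite {detection_index \<Gamma> g |g. g \<in> word_ball \<Gamma> S (2 * k) \<and> g \<noteq> \<one>\<^bsub>\<Gamma>\<^esub>}"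
      using finite_word_ball[OF assms(3), of \<Gamma> "2 * k"] by simp
  qed (use g_ball g_ne in blast)
  finally show ?thesis .
qed

end
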